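(* Let $M$ be a connected minimal surface in $E^3$ without parabolic points (i.e. its Gauss curvature $K$ vanishes nowhere), with position vector $x$ and unit normal $n$. Let $\rho\neq0$ be a real constant such that $1-2\rho H+\rho^2K\neq0$ everywhere on $M$, where $H$ is the mean curvature of $M$, and let $M^*$ be the parallel surface of $M$ in directed distance $\rho$, with position vector $x^*=x+\rho n$. Then $M^*$ is of null $III^*$-type $2$, where $III^*$ is the third fundamental form of $M^*$.
   Context: Surfaces are connected and sufficiently differentiable in Euclidean 3-space $E^3$. The parallel surface $M^*$ has the same unit normal vector $n$ as $M$. For a surface with Gauss map $n$ and nowhere vanishing Gauss curvature, the third fundamental form is $III=e_{ij}\,du^i\,du^j$ with $e_{ij}=\langle n_{/i},n_{/j}\rangle$, where $/i$ denotes $\partial/\partial u^i$; it is nondegenerate, and $(e^{ij})$ denotes the inverse of $(e_{ij})$. The second Beltrami operator with respect to $III$ is $\Delta^{III}\varphi:=-e^{ij}\nabla^{III}_i\varphi_{/j}$, where $\nabla^{III}_i$ is the covariant derivative (Levi-Civita connection of $III$) in the $u^i$ direction and repeated indices are summed; it is applied componentwise to vector-valued functions. A surface with position vector $x$ is of $III$-type $k$ if $x=c+x_1+\dots+x_k$ with $c$ a constant vector and nonconstant vector-valued functions $x_i$ satisfying $\Delta^{III}x_i=\lambda_i x_i$ for pairwise different real constants $\lambda_1,\dots,\lambda_k$; it is of null $III$-type $k$ if moreover $\lambda_i=0$ for some $i\in\{1,\dots,k\}$. The notion of null $III^*$-type $k$ for $M^*$ is this one, applied to $M^*$, its position vector $x^*$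 and its third fundamental form $III^*$. *)

theory Defs
  imports "HOL-Analysis.Analysis"
begin

section \<open>Calculus in a coordinate domain\<close>

definition pd :: "2 \<Rightarrow> (real^2 \<Rightarrow> 'b::real_normed_vector) \<Rightarrow> real^2 \<Rightarrow> 'b" where
  "pd i f u = frechet_derivative f (at u) (axis i 1)"

definition C1_on :: "(real^2) set \<Rightarrow> (real^2 \<Rightarrow> 'b::real_normed_vector) \<Rightarrow> bool" where
  "C1_on U f \<longleftrightarrow> f differentiable_on U \<and> (\<forall>i. continuous_on U (pd i f))"

definition C2_on :: "(real^2) set \<Rightarrow> (real^2 \<Rightarrow> 'b::real_normed_vector) \<Rightarrow> bool" where
  "C2_on U f \<longleftrightarrow> C1_on U f \<and> (\<forall>i. C1_on U (pd i f))"

text \<open>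
  Below, a metric on a coordinate domain is given by its matrix of coefficients as a function of
  the coordinates. \<open>christoffel g k i j\<close> is the symbol with upper index \<open>k\<close> and lower indices
  \<open>i\<close>, \<open>j\<close>, and \<open>cov_deriv g i w j\<close> is the \<open>j\<close>-th component of the covariant derivative, in the
  \<open>i\<close>-th coordinate direction, of the covector field with components \<open>w j\<close>.
\<close>

definition christoffel :: "(real^2 \<Rightarrow> real^2^2) \<Rightarrow> 2 \<Rightarrow> 2 \<Rightarrow> 2 \<Rightarrow> real^2 \<Rightarrow> real" where
  "christoffel g k i j u =
     (1/2) * (\<Sum>l\<in>UNIV. matrix_inv (g u) $ k $ l *
       (pd i (\<lambda>v. g v $ j $ l) u + pd j (\<lambda>v. g v $ i $ l) u - pd l (\<lambda>v. g v $ i $ j) u))"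

definition cov_deriv ::
  "(real^2 \<Rightarrow> real^2^2) \<Rightarrow> 2 \<Rightarrow> (2 \<Rightarrow> real^2 \<Rightarrow> real) \<Rightarrow> 2 \<Rightarrow> real^2 \<Rightarrow> real" where
  "cov_deriv g i w j u = pd i (w j) u - (\<Sum>k\<in>UNIV. christoffel g k i j u * w k u)"

definition beltrami :: "(real^2 \<Rightarrow> real^2^2) \<Rightarrow> (real^2 \<Rightarrow> real) \<Rightarrow> real^2 \<Rightarrow> real" where
  "beltrami g f u =
     - (\<Sum>i\<in>UNIV. \<Sum>j\<in>UNIV. matrix_inv (g u) $ i $ j * cov_deriv g i (\<lambda>k. pd k f) j u)"

section \<open>Surfaces in Euclidean 3-space\<close>

text \<open>
  A surface is an abstract 2-manifold together with an immersion (the position vector) and a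
  unit normal field. It is not taken to be a subset of \<open>real^3\<close>, because a parallel surface may
  intersect itself. A member \<open>(U, p)\<close> of the atlas is a local parametrization, with \<open>p\<close> mapping
  the coordinate domain \<open>U\<close> into the manifold.
\<close>

record 'a surf =
  carr :: "'a topology"
  atlas :: "((real^2) set \<times> (real^2 \<Rightarrow> 'a)) set"
  pos :: "'a \<Rightarrow> real^3"
  nrm :: "'a \<Rightarrow> real^3"

text \<open>
  Sufficient differentiability means here that position vector and unit normal are both of class
  \<open>C2\<close>: this is what the operator of the third fundamental form needs when applied to the position
  vector, it holds for every position vector of class \<open>C3\<close>, and it passes to parallel surfaces.
\<close>

definition surface :: "'a surf \<Rightarrow> bool" where
  "surface M \<longleftrightarrow>
     topspace (carr M) \<noteq> {} \<and> connected_space (carr M) \<and>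
     Hausdorff_space (carr M) \<and> second_countable (carr M) \<and>
     (\<Union>(U, p)\<in>atlas M. p ` U) = topspace (carr M) \<and>
     (\<forall>(U, p)\<in>atlas M.
        open U \<and> embedding_map (top_of_set U) (carr M) p \<and> openin (carr M) (p ` U)) \<and>
     (\<forall>(U, p)\<in>atlas M. \<forall>(V, q)\<in>atlas M. C2_on {u \<in> U. p u \<in> q ` V} (inv_into V q \<circ> p)) \<and>
     (\<forall>(U, p)\<in>atlas M.
        C2_on U (pos M \<circ> p) \<and> C2_on U (nrm M \<circ> p) \<and>
        (\<forall>u\<in>U. inj (frechet_derivative (pos M \<circ> p) (at u)) \<and>
           norm (nrm M (p u)) = 1 \<and> (\<forall>i. pd i (pos M \<circ> p) u \<bullet> nrm M (p u) = 0)))"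

definition form1 :: "'a surf \<Rightarrow> (real^2 \<Rightarrow> 'a) \<Rightarrow> real^2 \<Rightarrow> real^2^2" where
  "form1 M p u = (\<chi> i j. pd i (pos M \<circ> p) u \<bullet> pd j (pos M \<circ> p) u)"

definition form2 :: "'a surf \<Rightarrow> (real^2 \<Rightarrow> 'a) \<Rightarrow> real^2 \<Rightarrow> real^2^2" where
  "form2 M p u = (\<chi> i j. pd i (pd j (pos M \<circ> p)) u \<bullet> nrm M (p u))"

definition form3 :: "'a surf \<Rightarrow> (real^2 \<Rightarrow> 'a) \<Rightarrow> real^2 \<Rightarrow> real^2^2" where
  "form3 M p u = (\<chi> i j. pd i (nrm M \<circ> p) u \<bullet> pd j (nrm M \<circ> p) u)"

text \<open>
  Curvatures at the point \<open>p u\<close>. They do not depend on the local parametrization \<open>p\<close>, since the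
  normal is part of the surface and not derived from \<open>p\<close>.
\<close>

definition gauss_curv :: "'a surf \<Rightarrow> (real^2 \<Rightarrow> 'a) \<Rightarrow> real^2 \<Rightarrow> real" where
  "gauss_curv M p u = det (form2 M p u) / det (form1 M p u)"

definition mean_curv :: "'a surf \<Rightarrow> (real^2 \<Rightarrow> 'a) \<Rightarrow> real^2 \<Rightarrow> real" where
  "mean_curv M p u = (1/2) * trace (matrix_inv (form1 M p u) ** form2 M p u)"

definition minimal_surface :: "'a surf \<Rightarrow> bool" where
  "minimal_surface M \<longleftrightarrow> surface M \<and> (\<forall>(U, p)\<in>atlas M. \<forall>u\<in>U. mean_curv M p u = 0)"

definition no_parabolic_points :: "'a surf \<Rightarrow> bool" where
  "no_parabolic_points M \<longleftrightarrow> (\<forall>(U, p)\<in>atlas M. \<forall>u\<in>U. gauss_curv M p u \<noteq> 0)"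

definition parallel_surface :: "real \<Rightarrow> 'a surf \<Rightarrow> 'a surf" where
  "parallel_surface r M = M\<lparr>pos := (\<lambda>a. pos M a + r *\<^sub>R nrm M a)\<rparr>"

section \<open>Surfaces of finite type with respect to the third fundamental form\<close>

definition beltrami_III :: "'a surf \<Rightarrow> (real^2 \<Rightarrow> 'a) \<Rightarrow> ('a \<Rightarrow> real^3) \<Rightarrow> real^2 \<Rightarrow> real^3" where
  "beltrami_III M p f u = (\<chi> a. beltrami (form3 M p) (\<lambda>v. f (p v) $ a) u)"

definition eigenmap_III :: "'a surf \<Rightarrow> real \<Rightarrow> ('a \<Rightarrow> real^3) \<Rightarrow> bool" where
  "eigenmap_III M l f \<longleftrightarrow>
     (\<forall>(U, p)\<in>atlas M. C2_on U (f \<circ> p) \<and> (\<forall>u\<in>U. beltrami_III M p f u = l *\<^sub>R f (p u)))"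

definition III_decomposition ::
  "'a surf \<Rightarrow> nat \<Rightarrow> (nat \<Rightarrow> real) \<Rightarrow> real^3 \<Rightarrow> (nat \<Rightarrow> 'a \<Rightarrow> real^3) \<Rightarrow> bool" where
  "III_decomposition M k l c x \<longleftrightarrow>
     (\<forall>a\<in>topspace (carr M). pos M a = c + (\<Sum>i\<in>{1..k}. x i a)) \<and>
     (\<forall>i\<in>{1..k}. \<not> x i constant_on topspace (carr M) \<and> eigenmap_III M (l i) (x i)) \<and>
     inj_on l {1..k}"

definition III_type :: "'a surf \<Rightarrow> nat \<Rightarrow> bool" where
  "III_type M k \<longleftrightarrow>
     surface M \<and> no_parabolic_points M \<and> (\<exists>l c x. III_decomposition M k l c x)"

definition null_III_type :: "'a surf \<Rightarrow> nat \<Rightarrow> bool" where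
  "null_III_type M k \<longleftrightarrow>
     surface M \<and> no_parabolic_points M \<and>
     (\<exists>l c x. III_decomposition M k l c x \<and> (\<exists>i\<in>{1..k}. l i = 0))"

end

(* Since the normals agree, M and M* have the same third fundamental form III. The Gauss formula for
   the spherical image, n_ij = Gamma^k_ij n_k - e_ij n, gives Delta n = 2 n. Minimality means
   III = -K I, so the second fundamental form has trace zero with respect to III; by Codazzi's
   equation its III-divergence is the differential of this trace. The trace and the divergence are,
   up to sign, the normal and the tangential part of Delta x, so Delta x = 0, and x* = x + rho n is
   the required decomposition, with eigenvalues 0 and 2. *)

theory Submission
  imports Defs
begin

section \<open>Partial derivatives\<close>

text \<open>The second fundamental form is therefore carried, up to sign, as X_i . N_j: this can be
  differentiated once, and only second derivatives of X and N appear. Codazzi's equation is needed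
  for the connection of III rather than that of I; it follows from the Gauss formula for N and the
  symmetry of second derivatives. Vectors are tested against the frame N, N_1, N_2, which is a basis
  where III is nondegenerate. Inverse metrics are cleared by multiplying with determinants, so that
  the remaining identities are polynomial. The eigenvalue 2 is the dimension, as the trace of III
  with respect to itself. The claim also includes that M* is regular and without parabolic points:
  with H = 0 the condition on rho reads 1 + rho^2 K ~= 0, and K* = K / (1 + rho^2 K).\<close>

lemma pd_eqI: "(f has_derivative D) (at u) \<Longrightarrow> pd i f u = D (axis i 1)"
  by (metis frechet_derivative_at pd_def)

text \<open>No differentiability is required: both functions have the same set of derivatives at
  \<open>u\<close>, so the choice inside \<open>frechet_derivative\<close> selects the same one.
  This permits rewriting a first derivative on the whole chart before differentiating again.\<close>

lemma pd_cong_open: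
  assumes "open S" "u \<in> S" "\<And>v. v \<in> S \<Longrightarrow> f v = g v"
  shows "pd i f u = pd i g u"
proof -
  have "(f has_derivative D) (at u) \<longleftrightarrow> (g has_derivative D) (at u)" for D
    using has_derivative_transform_within_open[of f D u UNIV S g]
      has_derivative_transform_within_open[of g D u UNIV S f] assms by auto
  then show ?thesis
    by (simp add: pd_def frechet_derivative_def)
qed

lemma
  assumes "f differentiable (at u)" "g differentiable (at u)"
  shows pd_add: "pd i (\<lambda>v. f v + g v) u = pd i f u + pd i g u"
    and pd_diff: "pd i (\<lambda>v. f v - g v) u = pd i f u - pd i g u"
  by (rule pd_eqI[OF has_derivative_add[OF assms[unfolded frechet_derivative_works]], folded pd_def])
    (rule pd_eqI[OF has_derivative_diff[OF assms[unfolded frechet_derivative_works]], folded pd_def])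

lemma pd_scaleR:
  assumes "f differentiable (at u)"
  shows "pd i (\<lambda>v. c *\<^sub>R f v) u = c *\<^sub>R pd i f u"
  by (rule pd_eqI[OF has_derivative_scaleR_right[OF assms[unfolded frechet_derivative_works]], folded pd_def])

lemma pd_mult:
  fixes f g :: "real^2 \<Rightarrow> real"
  assumes "f differentiable (at u)" "g differentiable (at u)"
  shows "pd i (\<lambda>v. f v * g v) u = pd i f u * g u + f u * pd i g u"
  using pd_eqI[OF has_derivative_mult[OF assms[unfolded frechet_derivative_works]], folded pd_def]
  by (simp add: add.commute)

lemma pd_inner:
  fixes f g :: "real^2 \<Rightarrow> 'b::real_inner"
  assumes "f differentiable (at u)" "g differentiable (at u)"
  shows "pd i (\<lambda>v. f v \<bullet> g v) u = pd i f u \<bullet> g u + f u \<bullet> pd i g u"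
  using pd_eqI[OF has_derivative_inner[OF assms[unfolded frechet_derivative_works]], folded pd_def]
  by (simp add: add.commute)

lemma differentiable_inner_at:
  fixes f g :: "real^2 \<Rightarrow> 'b::real_inner"
  assumes "f differentiable (at u)" "g differentiable (at u)"
  shows "(\<lambda>v. f v \<bullet> g v) differentiable (at u)"
  using assms unfolding differentiable_def by (blast intro: has_derivative_inner)

lemma has_derivative_vec_nth:
  "(f has_derivative D) F \<Longrightarrow> ((\<lambda>v. f v $ a) has_derivative (\<lambda>h. D h $ a)) F"
  by (rule bounded_linear.has_derivative[OF bounded_linear_vec_nth])

lemma pd_vec_nth:
  fixes f :: "real^2 \<Rightarrow> real^'n"
  assumes "f differentiable (at u)"
  shows "pd i (\<lambda>v. f v $ a) u = pd i f u $ a"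
  by (rule pd_eqI[OF has_derivative_vec_nth[OF assms[unfolded frechet_derivative_works]], folded pd_def])

lemma frechet_derivative_eq_pd:
  assumes "f differentiable (at u)"
  shows "frechet_derivative f (at u) h = h $ 1 *\<^sub>R pd 1 f u + h $ 2 *\<^sub>R pd 2 f u"
proof -
  interpret linear "frechet_derivative f (at u)"
    by (rule linear_frechet_derivative[OF assms])
  have "h = h $ 1 *\<^sub>R axis 1 1 + h $ 2 *\<^sub>R axis 2 1"
    by (simp add: vec_eq_iff forall_2 axis_def)
  then show ?thesis
    unfolding pd_def by (metis add scale)
qed

section \<open>Closure properties of the classes C1 and C2\<close>

lemma C1_on_differentiable:
  "C1_on U f \<Longrightarrow> open U \<Longrightarrow> u \<in> U \<Longrightarrow> f differentiable (at u)"
  unfolding C1_on_def differentiable_on_def by (metis at_within_open)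

text \<open>The rules for \<open>pd\<close> give formulas that are guaranteed only on
  \<open>U\<close>; outside, \<open>frechet_derivative\<close> may be an unspecified value.\<close>

lemma C1_on_cong:
  assumes "open U" "\<And>u. u \<in> U \<Longrightarrow> f u = g u"
  shows "C1_on U f \<longleftrightarrow> C1_on U g"
proof -
  have "f differentiable_on U \<longleftrightarrow> g differentiable_on U"
    using assms(2) unfolding differentiable_on_def differentiable_def
    by (metis has_derivative_transform)
  moreover have "pd i f u = pd i g u" if "u \<in> U" for i u
    using assms that by (intro pd_cong_open) auto
  ultimately show ?thesis
    by (simp add: C1_on_def cong: continuous_on_cong)
qed

lemma C1_on_add:
  assumes "open U" "C1_on U f" "C1_on U g"
  shows "C1_on U (\<lambda>v. f v + g v)"
proof -
  have "pd i (\<lambda>v. f v + g v) u = pd i f u + pd i g u" if "u \<in> U" for i u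
    using assms that by (intro pd_add) (auto intro: C1_on_differentiable)
  with assms show ?thesis
    by (auto simp: C1_on_def intro!: differentiable_on_add continuous_on_add cong: continuous_on_cong)
qed

lemma C1_on_scaleR:
  assumes "open U" "C1_on U f"
  shows "C1_on U (\<lambda>v. c *\<^sub>R f v)"
proof -
  have "pd i (\<lambda>v. c *\<^sub>R f v) u = c *\<^sub>R pd i f u" if "u \<in> U" for i u
    using assms that by (intro pd_scaleR) (auto intro: C1_on_differentiable)
  moreover have "(\<lambda>v. c *\<^sub>R f v) differentiable_on U"
    using assms unfolding C1_on_def differentiable_on_def by (auto intro: differentiable_scaleR)
  ultimately show ?thesis
    using assms by (auto simp: C1_on_def intro!: continuous_on_scaleR continuous_on_const cong: continuous_on_cong)
qed

lemma C2_on_add: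
  assumes "open U" "C2_on U f" "C2_on U g"
  shows "C2_on U (\<lambda>v. f v + g v)"
proof -
  have "pd i (\<lambda>v. f v + g v) u = pd i f u + pd i g u" if "u \<in> U" for i u
    using assms that by (intro pd_add) (auto intro: C1_on_differentiable simp: C2_on_def)
  then have "C1_on U (pd i (\<lambda>v. f v + g v))" for i
    using assms by (subst C1_on_cong[of U _ "\<lambda>u. pd i f u + pd i g u"]) (auto intro: C1_on_add simp: C2_on_def)
  with assms show ?thesis
    by (auto simp: C2_on_def intro: C1_on_add)
qed

lemma C2_on_scaleR:
  assumes "open U" "C2_on U f"
  shows "C2_on U (\<lambda>v. c *\<^sub>R f v)"
proof -
  have "pd i (\<lambda>v. c *\<^sub>R f v) u = c *\<^sub>R pd i f u" if "u \<in> U" for i u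
    using assms that by (intro pd_scaleR) (auto intro: C1_on_differentiable simp: C2_on_def)
  then have "C1_on U (pd i (\<lambda>v. c *\<^sub>R f v))" for i
    using assms by (subst C1_on_cong[of U _ "\<lambda>u. c *\<^sub>R pd i f u"]) (auto intro: C1_on_scaleR simp: C2_on_def)
  with assms show ?thesis
    by (auto simp: C2_on_def intro: C1_on_scaleR)
qed

lemma
  assumes "C2_on U f" "open U" "u \<in> U"
  shows C2_on_differentiable: "f differentiable (at u)"
    and C2_on_pd_differentiable: "pd i f differentiable (at u)"
  using assms C1_on_differentiable unfolding C2_on_def by blast+

lemma C2_on_vec_nth:
  fixes f :: "real^2 \<Rightarrow> real^'n"
  assumes "open U" "C2_on U f"
  shows "C2_on U (\<lambda>v. f v $ a)"
proof -
  have C1: "C1_on U (\<lambda>v. g v $ a)" if "C1_on U g" for g :: "real^2 \<Rightarrow> real^'n"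
  proof -
    have "pd i (\<lambda>v. g v $ a) u = pd i g u $ a" if "u \<in> U" for i u
      using assms \<open>C1_on U g\<close> that by (intro pd_vec_nth) (auto intro: C1_on_differentiable)
    moreover have "(\<lambda>v. g v $ a) differentiable_on U"
      using that unfolding C1_on_def differentiable_on_def differentiable_def
      by (blast intro: has_derivative_vec_nth)
    ultimately show ?thesis
      using that by (auto simp: C1_on_def intro!: continuous_on_component cong: continuous_on_cong)
  qed
  have "pd i (\<lambda>v. f v $ a) u = pd i f u $ a" if "u \<in> U" for i u
    using assms that by (intro pd_vec_nth) (auto intro: C2_on_differentiable)
  then have "C1_on U (pd i (\<lambda>v. f v $ a))" for i
    using assms by (subst C1_on_cong[of U _ "\<lambda>u. pd i f u $ a"]) (auto intro: C1 simp: C2_on_def)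
  with assms C1 show ?thesis
    by (auto simp: C2_on_def)
qed

section \<open>Symmetry of second derivatives\<close>

lemma pd_along_line:
  fixes f :: "real^2 \<Rightarrow> real"
  assumes "f differentiable (at (u + s *\<^sub>R axis i 1))"
  shows "((\<lambda>s. f (u + s *\<^sub>R axis i 1)) has_real_derivative pd i f (u + s *\<^sub>R axis i 1)) (at s)"
proof -
  let ?D = "frechet_derivative f (at (u + s *\<^sub>R axis i 1))"
  have "((\<lambda>s. u + s *\<^sub>R axis i 1) has_derivative (\<lambda>h. h *\<^sub>R axis i 1)) (at s)"
    by (auto intro!: derivative_eq_intros)
  then have "((\<lambda>s. f (u + s *\<^sub>R axis i 1)) has_derivative (\<lambda>h. ?D (h *\<^sub>R axis i 1))) (at s)"
    using diff_chain_at[of "\<lambda>s. u + s *\<^sub>R axis i 1" _ s f ?D] assms[unfolded frechet_derivative_works]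
    by (simp add: o_def)
  moreover have "?D (h *\<^sub>R axis i 1) = pd i f (u + s *\<^sub>R axis i 1) * h" for h
    using linear_frechet_derivative[OF assms] by (simp add: pd_def linear_cmul)
  ultimately show ?thesis
    by (simp add: has_field_derivative_def)
qed

text \<open>Applied with both orders of the directions, this yields the symmetry of second derivatives.\<close>

lemma second_difference_eq_pd:
  fixes f :: "real^2 \<Rightarrow> real"
  assumes C2: "C2_on (ball u r) f" and t: "0 < t" "2 * t < r"
  obtains y where "y \<in> ball u (2 * t)"
    "f (u + t *\<^sub>R axis i 1 + t *\<^sub>R axis j 1) - f (u + t *\<^sub>R axis i 1) - f (u + t *\<^sub>R axis j 1) + f u
       = t\<^sup>2 * pd j (pd i f) y"
proof -
  \<comment> \<open>Used for two radii: t' = r/2 keeps all points in the domain, t' = t places the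
    intermediate point in the smaller ball. The bound on s + q is strict because balls are
    open.\<close>
  have mem: "u + s *\<^sub>R axis i 1 + q *\<^sub>R axis j 1 \<in> ball u (2 * t')"
    if "0 \<le> s" "s \<le> t'" "0 \<le> q" "q \<le> t'" "s + q < 2 * t'" for s q t'
  proof -
    have "norm (s *\<^sub>R axis i (1::real) + q *\<^sub>R axis j 1 :: real^2) \<le> s + q"
      using norm_triangle_ineq[of "s *\<^sub>R axis i (1::real) :: real^2" "q *\<^sub>R axis j 1"] that by simp
    moreover have "dist (u + (s *\<^sub>R axis i 1 + q *\<^sub>R axis j 1)) u
        = norm (s *\<^sub>R axis i (1::real) + q *\<^sub>R axis j 1 :: real^2)"
      by (simp only: dist_norm add_diff_cancel_left')
    ultimately show ?thesis
      using that by (simp add: dist_commute add.assoc)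
  qed
  have memr: "u + s *\<^sub>R axis i 1 + q *\<^sub>R axis j 1 \<in> ball u r" if "0 \<le> s" "s \<le> t" "0 \<le> q" "q \<le> t" for s q
    using mem[of s "r/2" q] that t by simp
  \<comment> \<open>The second difference is the increment of \<open>?F\<close> over [0, t], and the
    derivative of \<open>?F\<close> is an increment of \<open>pd i f\<close> in direction j. Two
    applications of the mean value theorem give the factor t^2.\<close>
  let ?F = "\<lambda>s. f (u + s *\<^sub>R axis i 1 + t *\<^sub>R axis j 1) - f (u + s *\<^sub>R axis i 1)"
  have "(?F has_real_derivative
          pd i f (u + s *\<^sub>R axis i 1 + t *\<^sub>R axis j 1) - pd i f (u + s *\<^sub>R axis i 1)) (at s)"
    if "0 \<le> s" "s \<le> t" for s
  proof (rule DERIV_diff)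
    have "f differentiable (at (u + s *\<^sub>R axis i 1 + t *\<^sub>R axis j 1))"
      using memr[OF that, of t] t by (intro C2_on_differentiable[OF C2 open_ball]) simp
    then show "((\<lambda>s. f (u + s *\<^sub>R axis i 1 + t *\<^sub>R axis j 1)) has_real_derivative
        pd i f (u + s *\<^sub>R axis i 1 + t *\<^sub>R axis j 1)) (at s)"
      using pd_along_line[of f "u + t *\<^sub>R axis j 1" s i] by (simp add: add_ac)
    show "((\<lambda>s. f (u + s *\<^sub>R axis i 1)) has_real_derivative pd i f (u + s *\<^sub>R axis i 1)) (at s)"
      using memr[OF that, of 0] t by (intro pd_along_line[of f u s i] C2_on_differentiable[OF C2 open_ball]) simp
  qed
  from MVT2[OF t(1) this] obtain s where s: "0 < s" "s < t"
    and Fs: "?F t - ?F 0 = t * (pd i f (u + s *\<^sub>R axis i 1 + t *\<^sub>R axis j 1) - pd i f (u + s *\<^sub>R axis i 1))"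
    by auto
  let ?G = "\<lambda>q. pd i f (u + s *\<^sub>R axis i 1 + q *\<^sub>R axis j 1)"
  have "(?G has_real_derivative pd j (pd i f) (u + s *\<^sub>R axis i 1 + q *\<^sub>R axis j 1)) (at q)"
    if "0 \<le> q" "q \<le> t" for q
    using memr[of s q] that s
    by (intro pd_along_line[of "pd i f" "u + s *\<^sub>R axis i 1" q j] C2_on_pd_differentiable[OF C2 open_ball]) simp
  from MVT2[OF t(1) this] obtain q where q: "0 < q" "q < t"
    and Gq: "?G t - ?G 0 = t * pd j (pd i f) (u + s *\<^sub>R axis i 1 + q *\<^sub>R axis j 1)"
    by auto
  show ?thesis
  proof
    show "u + s *\<^sub>R axis i 1 + q *\<^sub>R axis j 1 \<in> ball u (2 * t)"
      using s q by (intro mem) auto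
    have "f (u + t *\<^sub>R axis i 1 + t *\<^sub>R axis j 1) - f (u + t *\<^sub>R axis i 1) - f (u + t *\<^sub>R axis j 1) + f u
        = ?F t - ?F 0"
      by simp
    also have "\<dots> = t * (?G t - ?G 0)"
      unfolding Fs by simp
    also have "\<dots> = t\<^sup>2 * pd j (pd i f) (u + s *\<^sub>R axis i 1 + q *\<^sub>R axis j 1)"
      unfolding Gq by (simp add: power2_eq_square)
    finally show "f (u + t *\<^sub>R axis i 1 + t *\<^sub>R axis j 1) - f (u + t *\<^sub>R axis i 1) - f (u + t *\<^sub>R axis j 1) + f u
        = t\<^sup>2 * pd j (pd i f) (u + s *\<^sub>R axis i 1 + q *\<^sub>R axis j 1)" .
  qed
qed

text \<open>The second difference is symmetric in i and j, so the two mixed derivatives agree at two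
  points that may differ but both lie within 2 t of \<open>u\<close>. Letting t tend to 0,
  continuity gives equality at \<open>u\<close>.\<close>

lemma pd_commute_real:
  fixes f :: "real^2 \<Rightarrow> real"
  assumes "open U" "u \<in> U" "C2_on U f"
  shows "pd i (pd j f) u = pd j (pd i f) u"
proof -
  obtain r where r: "0 < r" "ball u r \<subseteq> U"
    using assms by (auto simp: open_contains_ball)
  then have C2: "C2_on (ball u r) f"
    using assms(3) unfolding C2_on_def C1_on_def
    by (meson continuous_on_subset differentiable_on_subset)
  \<comment> \<open>Here 2 * t n = r / (n + 2), which is below r already for n = 0; n + 1 would not
    be enough.\<close>
  define t where "t n = r / real (n + 2) / 2" for n
  have t: "0 < t n" "2 * t n < r" for n
    using r by (simp_all add: t_def field_simps add_pos_nonneg)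
  \<comment> \<open>Pairs, so that a single choice function supplies both sequences of intermediate
    points.\<close>
  have "\<exists>p. fst p \<in> ball u (2 * t n) \<and> snd p \<in> ball u (2 * t n) \<and>
      pd j (pd i f) (fst p) = pd i (pd j f) (snd p)" for n
  proof -
    obtain y where "y \<in> ball u (2 * t n)" "f (u + t n *\<^sub>R axis i 1 + t n *\<^sub>R axis j 1)
        - f (u + t n *\<^sub>R axis i 1) - f (u + t n *\<^sub>R axis j 1) + f u = (t n)\<^sup>2 * pd j (pd i f) y"
      using second_difference_eq_pd[OF C2 t] .
    moreover obtain z where "z \<in> ball u (2 * t n)" "f (u + t n *\<^sub>R axis j 1 + t n *\<^sub>R axis i 1)
        - f (u + t n *\<^sub>R axis j 1) - f (u + t n *\<^sub>R axis i 1) + f u = (t n)\<^sup>2 * pd i (pd j f) z"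
      using second_difference_eq_pd[OF C2 t] .
    moreover have "(t n)\<^sup>2 > 0"
      using t(1)[of n] by simp
    ultimately have "(t n)\<^sup>2 * pd j (pd i f) y = (t n)\<^sup>2 * pd i (pd j f) z"
      by (simp add: algebra_simps)
    with \<open>y \<in> _\<close> \<open>z \<in> _\<close> \<open>(t n)\<^sup>2 > 0\<close> show ?thesis
      by auto
  qed
  then have "\<exists>p. \<forall>n. fst (p n) \<in> ball u (2 * t n) \<and> snd (p n) \<in> ball u (2 * t n) \<and>
      pd j (pd i f) (fst (p n)) = pd i (pd j f) (snd (p n))"
    by (intro choice allI)
  then obtain p where p: "\<And>n. fst (p n) \<in> ball u (2 * t n)" "\<And>n. snd (p n) \<in> ball u (2 * t n)"
      "\<And>n. pd j (pd i f) (fst (p n)) = pd i (pd j f) (snd (p n))"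
    by blast
  have t0: "(\<lambda>n. 2 * t n) \<longlonglongrightarrow> 0"
  proof -
    have "2 * t n = r / real (n + 2)" for n
      using field_sum_of_halves[of "r / real (n + 2)"] by (simp only: t_def mult_2)
    then show ?thesis
      using LIMSEQ_ignore_initial_segment[OF lim_const_over_n, of r 2] by (simp only:)
  qed
  have lim: "w \<longlonglongrightarrow> u" if "\<And>n. w n \<in> ball u (2 * t n)" for w
  proof (rule metric_tendsto_imp_tendsto[OF t0 always_eventually], rule allI)
    show "dist (w n) u \<le> dist (2 * t n) 0" for n
      using that[of n] t(1)[of n] by (simp add: dist_commute)
  qed
  have cont: "isCont (pd a (pd b f)) u" for a b
    using assms by (auto simp: C2_on_def C1_on_def continuous_on_eq_continuous_at)
  have "(\<lambda>n. pd j (pd i f) (fst (p n))) \<longlonglongrightarrow> pd j (pd i f) u"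
    by (rule isCont_tendsto_compose[OF cont lim[OF p(1)]])
  moreover have "(\<lambda>n. pd j (pd i f) (fst (p n))) \<longlonglongrightarrow> pd i (pd j f) u"
    unfolding p(3) by (rule isCont_tendsto_compose[OF cont lim[OF p(2)]])
  ultimately show ?thesis
    using LIMSEQ_unique by blast
qed

lemma pd_pd_vec_nth:
  fixes f :: "real^2 \<Rightarrow> real^'n"
  assumes "open U" "u \<in> U" "C2_on U f"
  shows "pd i (pd j (\<lambda>v. f v $ a)) u = pd i (pd j f) u $ a"
proof -
  have "pd i (pd j (\<lambda>v. f v $ a)) u = pd i (\<lambda>v. pd j f v $ a) u"
    using assms by (intro pd_cong_open[OF assms(1,2)] pd_vec_nth) (rule C2_on_differentiable)
  then show ?thesis
    using assms by (simp add: pd_vec_nth C2_on_pd_differentiable)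
qed

lemma pd_commute:
  fixes f :: "real^2 \<Rightarrow> real^'n"
  assumes "open U" "u \<in> U" "C2_on U f"
  shows "pd i (pd j f) u = pd j (pd i f) u"
proof -
  have "pd i (pd j f) u $ a = pd j (pd i f) u $ a" for a
    using pd_commute_real[OF assms(1,2) C2_on_vec_nth[OF assms(1,3)], of i j a]
    unfolding pd_pd_vec_nth[OF assms] .
  then show ?thesis
    by (simp add: vec_eq_iff)
qed

section \<open>Linear algebra in dimensions two and three\<close>

lemma matrix_inv_2:
  fixes A :: "real^2^2"
  assumes "det A \<noteq> 0"
  shows "matrix_inv A $ 1 $ 1 = A $ 2 $ 2 / det A" "matrix_inv A $ 1 $ 2 = - A $ 1 $ 2 / det A"
    "matrix_inv A $ 2 $ 1 = - A $ 2 $ 1 / det A" "matrix_inv A $ 2 $ 2 = A $ 1 $ 1 / det A"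
proof -
  \<comment> \<open>On the type \<open>2\<close> the map i -> 3 - i swaps the two indices, so
    \<open>B\<close> is the adjugate divided by the determinant.\<close>
  define B :: "real^2^2" where "B = (\<chi> i j. if i = j then A $ (3 - i) $ (3 - j) / det A else - A $ i $ j / det A)"
  have B: "B $ 1 $ 1 = A $ 2 $ 2 / det A" "B $ 1 $ 2 = - A $ 1 $ 2 / det A"
    "B $ 2 $ 1 = - A $ 2 $ 1 / det A" "B $ 2 $ 2 = A $ 1 $ 1 / det A"
    by (simp_all add: B_def)
  have BA: "B ** A = mat 1"
    using assms
    by (simp add: vec_eq_iff forall_2 matrix_matrix_mult_def sum_2 B mat_def flip: add_divide_distrib diff_divide_distrib)
      (simp add: det_2 algebra_simps)
  have "A ** matrix_inv A = mat 1"
    using assms unfolding invertible_det_nz[symmetric] invertible_def matrix_inv_def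
    by (rule someI2_ex) simp
  then have "matrix_inv A = B"
    by (metis BA matrix_mul_assoc matrix_mul_lid matrix_mul_rid)
  then show "matrix_inv A $ 1 $ 1 = A $ 2 $ 2 / det A" "matrix_inv A $ 1 $ 2 = - A $ 1 $ 2 / det A"
    "matrix_inv A $ 2 $ 1 = - A $ 2 $ 1 / det A" "matrix_inv A $ 2 $ 2 = A $ 1 $ 1 / det A"
    by (simp_all add: B)
qed

text \<open>The matrix with rows n, a, b times its transpose is their Gram matrix; as n is a unit
  vector orthogonal to a and b, its determinant is the one in \<open>gram\<close>. So w lies in the
  kernel of an invertible matrix.\<close>

lemma eq_0_if_orthogonal_to_frame:
  fixes n a b w :: "real^3"
  assumes n: "n \<bullet> n = 1" "a \<bullet> n = 0" "b \<bullet> n = 0"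
    and gram: "(a \<bullet> a) * (b \<bullet> b) - (a \<bullet> b)\<^sup>2 \<noteq> 0"
    and w: "w \<bullet> n = 0" "w \<bullet> a = 0" "w \<bullet> b = 0"
  shows "w = 0"
proof -
  define A :: "real^3^3" where "A = vector [n, a, b]"
  have "(A ** transpose A) $ i $ j = A $ i \<bullet> A $ j" for i j
    by (simp add: matrix_matrix_mult_def transpose_def inner_vec_def)
  then have "det (A ** transpose A) = (a \<bullet> a) * (b \<bullet> b) - (a \<bullet> b)\<^sup>2"
    using n by (simp add: det_3 A_def inner_commute power2_eq_square)
  then have "det A \<noteq> 0"
    using gram by (auto simp: det_mul det_transpose)
  then have "inj ((*v) A)"
    using inj_matrix_vector_mult invertible_det_nz by blast
  moreover have "A *v w = A *v 0"
    using w by (simp add: vec_eq_iff forall_3 matrix_vector_mul_component A_def inner_commute)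
  ultimately show ?thesis
    by (blast dest: injD)
qed

text \<open>One formula for three metrics: I for the position vector, III for the normal, and I of
  the parallel surface for X + r N.\<close>

definition gram :: "(real^2 \<Rightarrow> 'b::real_inner) \<Rightarrow> real^2 \<Rightarrow> real^2^2" where
  "gram F u = (\<chi> i j. pd i F u \<bullet> pd j F u)"

lemma gram_nth [simp]: "gram F u $ i $ j = pd i F u \<bullet> pd j F u"
  by (simp add: gram_def)

lemma det_gram: "det (gram F u) = (pd 1 F u \<bullet> pd 1 F u) * (pd 2 F u \<bullet> pd 2 F u) - (pd 1 F u \<bullet> pd 2 F u)\<^sup>2"
  by (simp add: det_2 power2_eq_square inner_commute)

lemma inj_frechet_derivative_iff_det_gram:
  fixes F :: "real^2 \<Rightarrow> 'b::real_inner"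
  assumes F: "F differentiable (at u)"
  shows "inj (frechet_derivative F (at u)) \<longleftrightarrow> det (gram F u) \<noteq> 0"
proof -
  let ?L = "frechet_derivative F (at u)" and ?a = "pd 1 F u" and ?b = "pd 2 F u"
  let ?d = "(?a \<bullet> ?a) * (?b \<bullet> ?b) - (?a \<bullet> ?b)\<^sup>2"
  note L = frechet_derivative_eq_pd[OF F]
  have inj_iff: "inj ?L \<longleftrightarrow> (\<forall>h. ?L h = 0 \<longrightarrow> h = 0)"
    using linear_injective_0[OF linear_frechet_derivative[OF F]] .
  show ?thesis
    unfolding det_gram
  proof
    assume inj: "inj ?L"
    show "?d \<noteq> 0"
    proof
      assume d: "?d = 0"
      \<comment> \<open>A column of the adjugate of the Gram matrix. Its image is |b|^2 times the
        part of a orthogonal to b, hence orthogonal to b, and also to a because the determinant is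
        zero. So it vanishes, and injectivity forces b = 0.\<close>
      define h :: "real^2" where "h = vector [?b \<bullet> ?b, - (?a \<bullet> ?b)]"
      have Lh: "?L h = (?b \<bullet> ?b) *\<^sub>R ?a - (?a \<bullet> ?b) *\<^sub>R ?b"
        by (simp add: L h_def)
      have "?L h \<bullet> ?a = 0" "?L h \<bullet> ?b = 0"
        using d by (simp_all add: Lh inner_diff_left inner_commute[of ?b ?a] power2_eq_square algebra_simps)
      then have "?L h \<bullet> ?L h = 0"
        by (subst (2) Lh) (simp add: inner_diff_right)
      then have "h = 0"
        using inj inj_iff by simp
      then have "h $ 1 = 0"
        by simp
      then have "?b = 0"
        by (simp add: h_def)
      then have "?L (axis 2 1) = 0"
        by (simp add: pd_def)
      then have "axis 2 (1::real) = (0::real^2)"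
        using inj inj_iff by blast
      then show False
        by (simp add: axis_eq_0_iff)
    qed
  next
    assume d: "?d \<noteq> 0"
    have "h = 0" if "?L h = 0" for h
    proof -
      have 1: "h $ 1 * (?a \<bullet> ?a) + h $ 2 * (?a \<bullet> ?b) = 0"
        using arg_cong[OF that, of "\<lambda>x. x \<bullet> ?a"] by (simp add: L inner_add_left inner_commute[of ?b ?a])
      have 2: "h $ 1 * (?a \<bullet> ?b) + h $ 2 * (?b \<bullet> ?b) = 0"
        using arg_cong[OF that, of "\<lambda>x. x \<bullet> ?b"] by (simp add: L inner_add_left inner_commute[of ?b ?a])
      have "h $ 1 * ?d = 0" "h $ 2 * ?d = 0"
        using 1 2 by algebra+
      with d show ?thesis
        by (simp add: vec_eq_iff forall_2)
    qed
    then show "inj ?L"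
      using inj_iff by blast
  qed
qed

lemma not_constant_on_if_det_gram:
  assumes "open U" "u \<in> U" "det (gram F u) \<noteq> 0"
  shows "\<not> F constant_on U"
proof
  assume "F constant_on U"
  then obtain c where "\<And>v. v \<in> U \<Longrightarrow> F v = c"
    by (auto simp: constant_on_def)
  with assms(1,2) have "pd i F u = pd i (\<lambda>v. c) u" for i
    by (rule pd_cong_open)
  then have "pd i F u = 0" for i
    by (simp add: pd_def)
  with assms(3) show False
    by (simp add: det_gram)
qed

section \<open>The third fundamental form of a patch\<close>

text \<open>X and N stand for position vector and normal read in a chart. Nondegeneracy is left to
  hypotheses \<open>d\<close> of single lemmas: that of III for the operator, that of I for the
  Weingarten equations.\<close>

locale patch =
  fixes U :: "(real^2) set" and X N :: "real^2 \<Rightarrow> real^3"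
  assumes open_U: "open U" and X_C2: "C2_on U X" and N_C2: "C2_on U N"
    and norm_N: "u \<in> U \<Longrightarrow> norm (N u) = 1"
    and pd_X_inner_N: "u \<in> U \<Longrightarrow> pd i X u \<bullet> N u = 0"
begin

abbreviation third :: "real^2 \<Rightarrow> real^2^2" where
  "third \<equiv> gram N"

abbreviation \<Gamma> :: "2 \<Rightarrow> 2 \<Rightarrow> 2 \<Rightarrow> real^2 \<Rightarrow> real" where
  "\<Gamma> \<equiv> christoffel third"

text \<open>Since \<open>X\<^sub>i \<bullet> N = 0\<close>, this is the negative of the second fundamental form.\<close>

definition \<beta> :: "2 \<Rightarrow> 2 \<Rightarrow> real^2 \<Rightarrow> real" where
  "\<beta> i j u = pd i X u \<bullet> pd j N u"

context
  fixes u assumes u: "u \<in> U"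
begin

lemmas diff_simps = C2_on_differentiable[OF X_C2 open_U u] C2_on_differentiable[OF N_C2 open_U u]
  C2_on_pd_differentiable[OF X_C2 open_U u] C2_on_pd_differentiable[OF N_C2 open_U u]

lemma pd_pd_X_commute: "pd i (pd j X) u = pd j (pd i X) u"
  by (rule pd_commute[OF open_U u X_C2])

lemma pd_pd_N_commute: "pd i (pd j N) u = pd j (pd i N) u"
  by (rule pd_commute[OF open_U u N_C2])

lemma N_inner_N: "N u \<bullet> N u = 1"
  using norm_N[OF u] by (simp add: norm_eq_1)

end

lemma pd_N_inner_N:
  assumes u: "u \<in> U"
  shows "pd i N u \<bullet> N u = 0"
proof -
  have "pd i (\<lambda>v. N v \<bullet> N v) u = pd i (\<lambda>v. 1) u"
    using open_U u N_inner_N by (rule pd_cong_open)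
  then show ?thesis
    using u by (simp add: pd_inner diff_simps inner_commute) (simp add: pd_def)
qed

lemma
  assumes u: "u \<in> U"
  shows pd_pd_X_inner_N: "pd i (pd j X) u \<bullet> N u = - \<beta> j i u"
    and pd_pd_N_inner_N: "pd i (pd j N) u \<bullet> N u = - (pd i N u \<bullet> pd j N u)"
proof -
  have "pd i (\<lambda>v. pd j X v \<bullet> N v) u = pd i (\<lambda>v. 0) u" "pd i (\<lambda>v. pd j N v \<bullet> N v) u = pd i (\<lambda>v. 0) u"
    using open_U u pd_X_inner_N pd_N_inner_N by (auto intro: pd_cong_open)
  moreover have "pd i (\<lambda>v. 0 :: real) u = 0"
    by (simp add: pd_def)
  ultimately have "pd i (pd j X) u \<bullet> N u + pd j X u \<bullet> pd i N u = 0"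
    "pd i (pd j N) u \<bullet> N u + pd j N u \<bullet> pd i N u = 0"
    using u by (simp_all add: pd_inner diff_simps)
  then show "pd i (pd j X) u \<bullet> N u = - \<beta> j i u" "pd i (pd j N) u \<bullet> N u = - (pd i N u \<bullet> pd j N u)"
    by (simp_all add: \<beta>_def inner_commute)
qed

lemma \<beta>_commute:
  assumes "u \<in> U"
  shows "\<beta> i j u = \<beta> j i u"
  using pd_pd_X_inner_N[OF assms, of i j] pd_pd_X_inner_N[OF assms, of j i] pd_pd_X_commute[OF assms, of i j]
  by simp

section \<open>The connection of III and the Gauss formula for N\<close>

lemma pd_third:
  assumes "u \<in> U"
  shows "pd l (\<lambda>v. third v $ i $ j) u = pd l (pd i N) u \<bullet> pd j N u + pd i N u \<bullet> pd l (pd j N) u"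
  using assms by (simp add: pd_inner diff_simps)

lemma pd_\<beta>:
  assumes "u \<in> U"
  shows "pd l (\<beta> i j) u = pd l (pd i X) u \<bullet> pd j N u + pd i X u \<bullet> pd l (pd j N) u"
  using assms unfolding \<beta>_def by (simp add: pd_inner diff_simps)

text \<open>As e_ij = N_i . N_j, the three derivatives in the Christoffel symbol combine, by
  symmetry of N_ij, to twice N_ij . N_l.\<close>

lemma christoffel_third:
  assumes "u \<in> U"
  shows "\<Gamma> k i j u = (\<Sum>l\<in>UNIV. matrix_inv (third u) $ k $ l * (pd i (pd j N) u \<bullet> pd l N u))"
proof -
  have "pd i (\<lambda>v. third v $ j $ l) u + pd j (\<lambda>v. third v $ i $ l) u - pd l (\<lambda>v. third v $ i $ j) u
      = 2 * (pd i (pd j N) u \<bullet> pd l N u)" for l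
    unfolding pd_third[OF assms] pd_pd_N_commute[OF assms, of j i] pd_pd_N_commute[OF assms, of l]
    by (simp add: inner_commute)
  then show ?thesis
    unfolding christoffel_def by (simp add: sum_distrib_left)
qed

lemma \<Gamma>_commute: "u \<in> U \<Longrightarrow> \<Gamma> k i j u = \<Gamma> k j i u"
  by (simp add: christoffel_third pd_pd_N_commute[of u i j])

text \<open>Contraction with III cancels its inverse in \<open>christoffel_third\<close>; multiplied
  by det III this is a polynomial identity.\<close>

lemma christoffel_third_lower:
  assumes u: "u \<in> U" and d: "det (third u) \<noteq> 0"
  shows "\<Gamma> 1 i j u * (pd 1 N u \<bullet> pd l N u) + \<Gamma> 2 i j u * (pd 2 N u \<bullet> pd l N u) = pd i (pd j N) u \<bullet> pd l N u"
proof -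
  let ?D = "det (third u)"
  have 1: "?D * \<Gamma> 1 i j u = (pd 2 N u \<bullet> pd 2 N u) * (pd i (pd j N) u \<bullet> pd 1 N u)
      - (pd 1 N u \<bullet> pd 2 N u) * (pd i (pd j N) u \<bullet> pd 2 N u)"
    and 2: "?D * \<Gamma> 2 i j u = (pd 1 N u \<bullet> pd 1 N u) * (pd i (pd j N) u \<bullet> pd 2 N u)
      - (pd 1 N u \<bullet> pd 2 N u) * (pd i (pd j N) u \<bullet> pd 1 N u)"
    using d by (simp_all add: christoffel_third[OF u] sum_2 matrix_inv_2[OF d] distrib_left right_diff_distrib inner_commute)
  have "?D * (\<Gamma> 1 i j u * (pd 1 N u \<bullet> pd l N u) + \<Gamma> 2 i j u * (pd 2 N u \<bullet> pd l N u))
      = ?D * \<Gamma> 1 i j u * (pd 1 N u \<bullet> pd l N u) + ?D * \<Gamma> 2 i j u * (pd 2 N u \<bullet> pd l N u)"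
    by (simp add: algebra_simps)
  also have "\<dots> = ?D * (pd i (pd j N) u \<bullet> pd l N u)"
    unfolding 1 2
    unfolding det_gram using exhaust_2[of l]
    by (auto simp: inner_commute[of "pd 2 N u" "pd 1 N u"] power2_eq_square algebra_simps)
  finally show ?thesis
    using d by simp
qed

text \<open>Both sides have the same inner products with the frame: \<open>pd_pd_N_inner_N\<close>
  gives the one with N, \<open>christoffel_third_lower\<close> the tangential ones.\<close>

lemma gauss_formula_N:
  assumes u: "u \<in> U" and d: "det (third u) \<noteq> 0"
  shows "pd i (pd j N) u = \<Gamma> 1 i j u *\<^sub>R pd 1 N u + \<Gamma> 2 i j u *\<^sub>R pd 2 N u - (pd i N u \<bullet> pd j N u) *\<^sub>R N u"
    (is "_ = ?R")
proof -
  have "pd i (pd j N) u - ?R = 0"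
  proof (rule eq_0_if_orthogonal_to_frame[of "N u" "pd 1 N u" "pd 2 N u"])
    show "(pd 1 N u \<bullet> pd 1 N u) * (pd 2 N u \<bullet> pd 2 N u) - (pd 1 N u \<bullet> pd 2 N u)\<^sup>2 \<noteq> 0"
      using d by (simp add: det_gram)
    show "N u \<bullet> N u = 1" "pd 1 N u \<bullet> N u = 0" "pd 2 N u \<bullet> N u = 0" "(pd i (pd j N) u - ?R) \<bullet> N u = 0"
      using u by (simp_all add: N_inner_N pd_N_inner_N pd_pd_N_inner_N inner_diff_left inner_add_left)
    have "(pd i (pd j N) u - ?R) \<bullet> pd l N u = 0" for l
      using christoffel_third_lower[OF u d, of i j l] pd_N_inner_N[OF u, of l]
      by (simp add: inner_diff_left inner_add_left inner_commute[of "N u"])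
    then show "(pd i (pd j N) u - ?R) \<bullet> pd 1 N u = 0" "(pd i (pd j N) u - ?R) \<bullet> pd 2 N u = 0"
      by blast+
  qed
  then show ?thesis
    by simp
qed

text \<open>The covariant Hessian of the three components of \<open>F\<close> with respect to III;
  Delta F is minus its III-trace.\<close>

definition hess :: "(real^2 \<Rightarrow> real^3) \<Rightarrow> 2 \<Rightarrow> 2 \<Rightarrow> real^2 \<Rightarrow> real^3" where
  "hess F i j u = pd i (pd j F) u - (\<Gamma> 1 i j u *\<^sub>R pd 1 F u + \<Gamma> 2 i j u *\<^sub>R pd 2 F u)"

text \<open>det III times the inverse of III is the adjugate, which explains the coefficients e_22,
  -e_12, -e_12, e_11.\<close>

lemma beltrami_third_vector:
  assumes u: "u \<in> U" and F: "C2_on U F" and d: "det (third u) \<noteq> 0"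
  shows "det (third u) *\<^sub>R (\<chi> a. beltrami third (\<lambda>v. F v $ a) u) =
    - ((pd 2 N u \<bullet> pd 2 N u) *\<^sub>R hess F 1 1 u - (pd 1 N u \<bullet> pd 2 N u) *\<^sub>R hess F 1 2 u
       - (pd 1 N u \<bullet> pd 2 N u) *\<^sub>R hess F 2 1 u + (pd 1 N u \<bullet> pd 1 N u) *\<^sub>R hess F 2 2 u)"
proof -
  have "cov_deriv third i (\<lambda>k. pd k (\<lambda>v. F v $ a)) j u = hess F i j u $ a" for i j a
    using pd_pd_vec_nth[OF open_U u F] pd_vec_nth[OF C2_on_differentiable[OF F open_U u]]
    by (simp add: cov_deriv_def hess_def sum_2)
  then show ?thesis
    using d by (simp add: vec_eq_iff beltrami_def sum_2 matrix_inv_2[OF d] inner_commute algebra_simps)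
qed

lemma beltrami_third_N:
  assumes u: "u \<in> U" and d: "det (third u) \<noteq> 0"
  shows "(\<chi> a. beltrami third (\<lambda>v. N v $ a) u) = 2 *\<^sub>R N u"
proof -
  have "hess N i j u = - (pd i N u \<bullet> pd j N u) *\<^sub>R N u" for i j
    by (simp add: hess_def gauss_formula_N[OF u d])
  then have "det (third u) *\<^sub>R (\<chi> a. beltrami third (\<lambda>v. N v $ a) u) = (2 * det (third u)) *\<^sub>R N u"
    unfolding beltrami_third_vector[OF u N_C2 d]
    by (simp add: inner_commute[of "pd 2 N u" "pd 1 N u"] flip: scaleR_add_left scaleR_diff_left scaleR_minus_left)
      (simp add: det_gram power2_eq_square)
  then have "det (third u) *\<^sub>R (\<chi> a. beltrami third (\<lambda>v. N v $ a) u) = det (third u) *\<^sub>R 2 *\<^sub>R N u"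
    by (simp add: mult.commute)
  with d show ?thesis
    by (simp only: real_vector.scale_cancel_left simp_thms)
qed

section \<open>Codazzi's equation and Delta of the position vector\<close>

lemma hess_X_commute: "u \<in> U \<Longrightarrow> hess X i j u = hess X j i u"
  by (simp add: hess_def pd_pd_X_commute[of u i j] \<Gamma>_commute[of u _ i j])

lemma hess_X_inner_N: "u \<in> U \<Longrightarrow> hess X i j u \<bullet> N u = - \<beta> i j u"
  by (simp add: hess_def inner_diff_left inner_add_left pd_X_inner_N pd_pd_X_inner_N \<beta>_commute[of u i j])

text \<open>By the product rule X_ij . N_l is the i-th derivative of \<open>\<beta> j l\<close>
  minus X_j . N_il; in the Gauss formula for N_il the normal part drops because X_j . N = 0.\<close>

lemma hess_X_inner_pd_N:
  assumes u: "u \<in> U" and d: "det (third u) \<noteq> 0"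
  shows "hess X i j u \<bullet> pd l N u = pd i (\<beta> j l) u - (\<Gamma> 1 i l u * \<beta> j 1 u + \<Gamma> 2 i l u * \<beta> j 2 u)
    - (\<Gamma> 1 i j u * \<beta> 1 l u + \<Gamma> 2 i j u * \<beta> 2 l u)"
  by (simp add: hess_def inner_diff_left inner_add_left pd_\<beta>[OF u] gauss_formula_N[OF u d, of i l]
      inner_diff_right inner_add_right pd_X_inner_N[OF u] flip: \<beta>_def)

text \<open>By \<open>hess_X_inner_pd_N\<close>, both sides are components of the covariant derivative of \<open>\<beta>\<close> with respect to the third
  fundamental form, which is thus symmetric in all three indices.\<close>

lemma codazzi:
  assumes u: "u \<in> U" and d: "det (third u) \<noteq> 0"
  shows "hess X i j u \<bullet> pd l N u = hess X l i u \<bullet> pd j N u"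
proof -
  have "pd i (\<beta> j l) u = pd i (\<beta> l j) u"
    using open_U u \<beta>_commute by (rule pd_cong_open)
  then have "hess X i j u \<bullet> pd l N u = hess X i l u \<bullet> pd j N u"
    unfolding hess_X_inner_pd_N[OF u d] by (simp add: \<beta>_commute[OF u, of 1] \<beta>_commute[OF u, of 2])
  then show ?thesis
    by (simp add: hess_X_commute[OF u, of i l])
qed

text \<open>The left side of \<open>trace\<close> is det III times the III-trace of \<beta>. At
  \<open>u\<close> it gives the normal part of Delta X; the tangential part needs its derivative,
  hence the assumption on all of \<open>U\<close>.\<close>

lemma beltrami_third_X:
  assumes u: "u \<in> U" and d: "det (third u) \<noteq> 0"
    and trace: "\<And>v. v \<in> U \<Longrightarrow> (pd 2 N v \<bullet> pd 2 N v) * \<beta> 1 1 v - (pd 1 N v \<bullet> pd 2 N v) * \<beta> 1 2 v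
      - (pd 1 N v \<bullet> pd 2 N v) * \<beta> 2 1 v + (pd 1 N v \<bullet> pd 1 N v) * \<beta> 2 2 v = 0"
  shows "(\<chi> a. beltrami third (\<lambda>v. X v $ a) u) = 0"
proof -
  \<comment> \<open>W is minus det III times Delta X.\<close>
  define W where "W = (pd 2 N u \<bullet> pd 2 N u) *\<^sub>R hess X 1 1 u - (pd 1 N u \<bullet> pd 2 N u) *\<^sub>R hess X 1 2 u
       - (pd 1 N u \<bullet> pd 2 N u) *\<^sub>R hess X 2 1 u + (pd 1 N u \<bullet> pd 1 N u) *\<^sub>R hess X 2 2 u"
  have W_pd_N: "W \<bullet> pd l N u = 0" for l
  proof -
    have diff: "(\<lambda>v. pd i N v \<bullet> pd j N v) differentiable (at u)" "\<beta> i j differentiable (at u)" for i j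
      unfolding \<beta>_def using u by (intro differentiable_inner_at diff_simps; simp)+
    define e where "e i j = pd i N u \<bullet> pd j N u" for i j
    define de where "de i j = pd l (\<lambda>v. pd i N v \<bullet> pd j N v) u" for i j
    have "pd l (\<lambda>v. (pd 2 N v \<bullet> pd 2 N v) * \<beta> 1 1 v - (pd 1 N v \<bullet> pd 2 N v) * \<beta> 1 2 v
      - (pd 1 N v \<bullet> pd 2 N v) * \<beta> 2 1 v + (pd 1 N v \<bullet> pd 1 N v) * \<beta> 2 2 v) u = pd l (\<lambda>v. 0 :: real) u"
      using open_U u trace by (rule pd_cong_open)
    also have "\<dots> = 0"
      by (simp add: pd_def)
    finally have dtrace: "(de 2 2 * \<beta> 1 1 u + e 2 2 * pd l (\<beta> 1 1) u)
        - (de 1 2 * \<beta> 1 2 u + e 1 2 * pd l (\<beta> 1 2) u)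
        - (de 1 2 * \<beta> 2 1 u + e 1 2 * pd l (\<beta> 2 1) u)
        + (de 1 1 * \<beta> 2 2 u + e 1 1 * pd l (\<beta> 2 2) u) = 0"
      by (simp add: pd_add pd_diff pd_mult differentiable_add differentiable_diff differentiable_mult diff e_def de_def)
    \<comment> \<open>Metric compatibility: III is parallel for its own connection.\<close>
    have de: "de i j = (\<Gamma> 1 l i u * e 1 j + \<Gamma> 2 l i u * e 2 j) + (\<Gamma> 1 l j u * e 1 i + \<Gamma> 2 l j u * e 2 i)" for i j
      unfolding de_def e_def christoffel_third_lower[OF u d]
      using pd_third[OF u, of l i j] by (simp add: inner_commute)
    have tr: "e 2 2 * \<beta> 1 1 u - e 1 2 * \<beta> 1 2 u - e 1 2 * \<beta> 2 1 u + e 1 1 * \<beta> 2 2 u = 0"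
      using trace[OF u] by (simp add: e_def)
    have sym: "e 2 1 = e 1 2" "\<beta> 2 1 u = \<beta> 1 2 u"
      using \<beta>_commute[OF u] by (simp_all add: e_def inner_commute)
    \<comment> \<open>Codazzi's symmetry moves l into the derivative slot, turning the divergence of
      \<beta> into the trace of its derivative along l.\<close>
    have "W \<bullet> pd l N u = e 2 2 * (hess X l 1 u \<bullet> pd 1 N u) - e 1 2 * (hess X l 1 u \<bullet> pd 2 N u)
        - e 1 2 * (hess X l 2 u \<bullet> pd 1 N u) + e 1 1 * (hess X l 2 u \<bullet> pd 2 N u)"
      by (simp add: W_def inner_add_left inner_diff_left codazzi[OF u d, of _ _ l] e_def)
    also have "\<dots> = 0"
      \<comment> \<open>\<open>dtrace\<close> differentiates det III times the trace, not the trace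
        itself. The surplus term is a multiple of the trace, which \<open>tr\<close>
        removes.\<close>
      using dtrace tr unfolding hess_X_inner_pd_N[OF u d] de sym by algebra
    finally show ?thesis .
  qed
  have "W = 0"
  proof (rule eq_0_if_orthogonal_to_frame[of "N u" "pd 1 N u" "pd 2 N u"])
    show "(pd 1 N u \<bullet> pd 1 N u) * (pd 2 N u \<bullet> pd 2 N u) - (pd 1 N u \<bullet> pd 2 N u)\<^sup>2 \<noteq> 0"
      using d by (simp add: det_gram)
    show "W \<bullet> N u = 0"
      using trace[OF u] by (simp add: W_def inner_add_left inner_diff_left hess_X_inner_N[OF u])
  qed (use u in \<open>simp_all add: N_inner_N pd_N_inner_N W_pd_N\<close>)
  then show ?thesis
    using beltrami_third_vector[OF u X_C2 d] d by (simp add: W_def)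
qed

text \<open>N_i is tangential since N has constant length. Its components along X_1, X_2 solve a
  linear system with matrix I and right side given by \<beta>; this is Cramer's rule with det I
  cleared.\<close>

lemma weingarten:
  assumes u: "u \<in> U" and d: "det (gram X u) \<noteq> 0"
  shows "det (gram X u) *\<^sub>R pd i N u =
    (\<beta> 1 i u * (pd 2 X u \<bullet> pd 2 X u) - \<beta> 2 i u * (pd 1 X u \<bullet> pd 2 X u)) *\<^sub>R pd 1 X u +
    (\<beta> 2 i u * (pd 1 X u \<bullet> pd 1 X u) - \<beta> 1 i u * (pd 1 X u \<bullet> pd 2 X u)) *\<^sub>R pd 2 X u" (is "_ = ?R")
proof -
  have "det (gram X u) *\<^sub>R pd i N u - ?R = 0"
  proof (rule eq_0_if_orthogonal_to_frame[of "N u" "pd 1 X u" "pd 2 X u"])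
    show "(pd 1 X u \<bullet> pd 1 X u) * (pd 2 X u \<bullet> pd 2 X u) - (pd 1 X u \<bullet> pd 2 X u)\<^sup>2 \<noteq> 0"
      using d by (simp add: det_gram)
    show "(det (gram X u) *\<^sub>R pd i N u - ?R) \<bullet> pd 1 X u = 0" "(det (gram X u) *\<^sub>R pd i N u - ?R) \<bullet> pd 2 X u = 0"
      by (simp_all add: inner_diff_left inner_add_left det_gram \<beta>_def inner_commute power2_eq_square algebra_simps)
  qed (use u in \<open>simp_all add: N_inner_N pd_X_inner_N pd_N_inner_N inner_diff_left inner_add_left\<close>)
  then show ?thesis
    by simp
qed

lemma
  assumes u: "u \<in> U"
  shows pd_parallel: "pd i (\<lambda>v. X v + r *\<^sub>R N v) u = pd i X u + r *\<^sub>R pd i N u"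
    and pd_pd_parallel: "pd i (pd j (\<lambda>v. X v + r *\<^sub>R N v)) u = pd i (pd j X) u + r *\<^sub>R pd i (pd j N) u"
proof -
  have 1: "pd i (\<lambda>v. X v + r *\<^sub>R N v) v = pd i X v + r *\<^sub>R pd i N v" if "v \<in> U" for i v
    using that by (simp add: pd_add pd_scaleR diff_simps differentiable_scaleR)
  then show "pd i (\<lambda>v. X v + r *\<^sub>R N v) u = pd i X u + r *\<^sub>R pd i N u"
    using u .
  have "pd i (pd j (\<lambda>v. X v + r *\<^sub>R N v)) u = pd i (\<lambda>v. pd j X v + r *\<^sub>R pd j N v) u"
    using open_U u 1 by (rule pd_cong_open)
  then show "pd i (pd j (\<lambda>v. X v + r *\<^sub>R N v)) u = pd i (pd j X) u + r *\<^sub>R pd i (pd j N) u"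
    using u by (simp add: pd_add pd_scaleR diff_simps differentiable_scaleR)
qed

lemma beltrami_third_scaleR:
  fixes F :: "real^2 \<Rightarrow> real^3"
  assumes u: "u \<in> U" and F: "C2_on U F" and d: "det (third u) \<noteq> 0"
  shows "(\<chi> a. beltrami third (\<lambda>v. (c *\<^sub>R F v) $ a) u) = c *\<^sub>R (\<chi> a. beltrami third (\<lambda>v. F v $ a) u)"
proof -
  have pd: "pd i (\<lambda>v. c *\<^sub>R F v) v = c *\<^sub>R pd i F v" if "v \<in> U" for i v
    by (rule pd_scaleR[OF C2_on_differentiable[OF F open_U that]])
  have "pd i (pd j (\<lambda>v. c *\<^sub>R F v)) u = pd i (\<lambda>v. c *\<^sub>R pd j F v) u" for i j
    using open_U u pd by (rule pd_cong_open)
  then have hess: "hess (\<lambda>v. c *\<^sub>R F v) i j u = c *\<^sub>R hess F i j u" for i j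
    by (simp add: hess_def pd u pd_scaleR[OF C2_on_pd_differentiable[OF F open_U u]] algebra_simps)
  have "det (third u) *\<^sub>R (\<chi> a. beltrami third (\<lambda>v. (c *\<^sub>R F v) $ a) u)
      = c *\<^sub>R (det (third u) *\<^sub>R (\<chi> a. beltrami third (\<lambda>v. F v $ a) u))"
    unfolding beltrami_third_vector[OF u F d] beltrami_third_vector[OF u C2_on_scaleR[OF open_U F] d] hess
    by (simp add: algebra_simps)
  also have "\<dots> = det (third u) *\<^sub>R (c *\<^sub>R (\<chi> a. beltrami third (\<lambda>v. F v $ a) u))"
    by (simp only: scaleR_scaleR mult.commute)
  finally show ?thesis
    using d by (simp only: real_vector.scale_cancel_left simp_thms)
qed

end

section \<open>Minimal patches: III is conformal to I\<close>

locale minimal_patch = patch +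
  assumes regular: "u \<in> U \<Longrightarrow> det (gram X u) \<noteq> 0"
    and minimal: "u \<in> U \<Longrightarrow> (pd 2 X u \<bullet> pd 2 X u) * \<beta> 1 1 u - 2 * (pd 1 X u \<bullet> pd 2 X u) * \<beta> 1 2 u
      + (pd 1 X u \<bullet> pd 1 X u) * \<beta> 2 2 u = 0"
    and nonparabolic: "u \<in> U \<Longrightarrow> \<beta> 1 1 u * \<beta> 2 2 u - (\<beta> 1 2 u)\<^sup>2 \<noteq> 0"
begin

definition K :: "real^2 \<Rightarrow> real" where
  "K u = (\<beta> 1 1 u * \<beta> 2 2 u - (\<beta> 1 2 u)\<^sup>2) / det (gram X u)"

lemma K_nonzero: "u \<in> U \<Longrightarrow> K u \<noteq> 0"
  using regular nonparabolic by (simp add: K_def)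

lemma det_\<beta>: "u \<in> U \<Longrightarrow> \<beta> 1 1 u * \<beta> 2 2 u - (\<beta> 1 2 u)\<^sup>2 = K u * det (gram X u)"
  using regular by (simp add: K_def)

text \<open>The Cayley-Hamilton relation III - 2 H II + K I = 0 of the shape operator, at H = 0. The
  Weingarten equations turn it into a polynomial identity for each pair of indices.\<close>

lemma third_eq:
  assumes u: "u \<in> U"
  shows "pd i N u \<bullet> pd j N u = - K u * (pd i X u \<bullet> pd j X u)"
proof -
  let ?g = "\<lambda>i j. pd i X u \<bullet> pd j X u"
  have sym: "\<beta> 2 1 u = \<beta> 1 2 u" "?g 2 1 = ?g 1 2"
    using \<beta>_commute[OF u] by (simp_all add: inner_commute)
  have "det (gram X u) * (pd i N u \<bullet> pd j N u) =
      (\<beta> 1 i u * ?g 2 2 - \<beta> 2 i u * ?g 1 2) * \<beta> 1 j u + (\<beta> 2 i u * ?g 1 1 - \<beta> 1 i u * ?g 1 2) * \<beta> 2 j u"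
    using arg_cong[OF weingarten[OF u regular[OF u], of i], of "\<lambda>x. x \<bullet> pd j N u"]
    by (simp add: inner_add_left \<beta>_def)
  also have "\<dots> = - (\<beta> 1 1 u * \<beta> 2 2 u - (\<beta> 1 2 u)\<^sup>2) * ?g i j"
  proof -
    let ?P = "\<lambda>i j. (\<beta> 1 i u * ?g 2 2 - \<beta> 2 i u * ?g 1 2) * \<beta> 1 j u + (\<beta> 2 i u * ?g 1 1 - \<beta> 1 i u * ?g 1 2) * \<beta> 2 j u
        = - (\<beta> 1 1 u * \<beta> 2 2 u - (\<beta> 1 2 u)\<^sup>2) * ?g i j"
    have "?P 1 1" "?P 1 2" "?P 2 1" "?P 2 2"
      using minimal[OF u] unfolding sym by algebra+
    then show "?P i j"
      using exhaust_2[of i] exhaust_2[of j] by (elim disjE) (simp_all only:)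
  qed
  also have "\<dots> = det (gram X u) * (- K u * ?g i j)"
    by (simp add: det_\<beta>[OF u])
  finally show ?thesis
    using regular[OF u] by (simp only: mult_cancel_left simp_thms)
qed

lemma det_third_nonzero:
  assumes "u \<in> U"
  shows "det (third u) \<noteq> 0"
proof -
  have "det (third u) = (K u)\<^sup>2 * det (gram X u)"
    by (simp add: det_gram third_eq[OF assms] power2_eq_square algebra_simps)
  then show ?thesis
    using assms regular K_nonzero by simp
qed

text \<open>By \<open>third_eq\<close>, the trace condition for III is -K times
  \<open>minimal\<close>.\<close>

lemma beltrami_X:
  assumes u: "u \<in> U"
  shows "(\<chi> a. beltrami third (\<lambda>v. X v $ a) u) = 0"
proof (rule beltrami_third_X[OF u det_third_nonzero[OF u]])
  fix v assume v: "v \<in> U"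
  show "(pd 2 N v \<bullet> pd 2 N v) * \<beta> 1 1 v - (pd 1 N v \<bullet> pd 2 N v) * \<beta> 1 2 v
      - (pd 1 N v \<bullet> pd 2 N v) * \<beta> 2 1 v + (pd 1 N v \<bullet> pd 1 N v) * \<beta> 2 2 v = 0"
    using minimal[OF v] unfolding third_eq[OF v] \<beta>_commute[OF v, of 2 1] by algebra
qed

lemma beltrami_N: "u \<in> U \<Longrightarrow> (\<chi> a. beltrami third (\<lambda>v. N v $ a) u) = 2 *\<^sub>R N u"
  by (rule beltrami_third_N[OF _ det_third_nonzero])

text \<open>I* = I + 2 r \<beta> + r^2 III with III = -K I.\<close>

lemma gram_parallel:
  assumes u: "u \<in> U"
  shows "gram (\<lambda>v. X v + r *\<^sub>R N v) u $ i $ j = (1 - r\<^sup>2 * K u) * (pd i X u \<bullet> pd j X u) + 2 * r * \<beta> i j u"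
proof -
  have "pd i N u \<bullet> pd j X u = \<beta> i j u" "pd i X u \<bullet> pd j N u = \<beta> i j u"
    using \<beta>_commute[OF u, of i j] by (simp_all add: \<beta>_def inner_commute)
  then show ?thesis
    by (simp add: pd_parallel[OF u] inner_add_left inner_add_right third_eq[OF u] power2_eq_square algebra_simps)
qed

text \<open>The mixed term of the determinant is a multiple of the vanishing trace, which leaves (1
  - r^2 K)^2 + 4 r^2 K as factor of det I. Geometrically, with principal curvatures k and -k,
  lengths are scaled by 1 - r k and 1 + r k.\<close>

lemma det_gram_parallel:
  assumes u: "u \<in> U"
  shows "det (gram (\<lambda>v. X v + r *\<^sub>R N v) u) = (1 + r\<^sup>2 * K u)\<^sup>2 * det (gram X u)"
proof -
  have sym: "\<beta> 2 1 u = \<beta> 1 2 u" "pd 2 X u \<bullet> pd 1 X u = pd 1 X u \<bullet> pd 2 X u"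
    using \<beta>_commute[OF u] by (simp_all add: inner_commute)
  show ?thesis
    using minimal[OF u] det_\<beta>[OF u] unfolding det_2[of "gram (\<lambda>v. X v + r *\<^sub>R N v) u"] gram_parallel[OF u]
    unfolding det_gram sym by algebra
qed

text \<open>II* = r K I - \<beta>, and the mixed term vanishes again. Division by
  \<open>det_gram_parallel\<close> gives K* = K / (1 + r^2 K).\<close>

lemma det_second_parallel:
  assumes u: "u \<in> U"
  shows "det ((\<chi> i j. pd i (pd j (\<lambda>v. X v + r *\<^sub>R N v)) u \<bullet> N u) :: real^2^2)
    = K u * (1 + r\<^sup>2 * K u) * det (gram X u)"
proof -
  have sym: "\<beta> 2 1 u = \<beta> 1 2 u" "pd 2 X u \<bullet> pd 1 X u = pd 1 X u \<bullet> pd 2 X u"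
    using \<beta>_commute[OF u] by (simp_all add: inner_commute)
  have "pd i (pd j (\<lambda>v. X v + r *\<^sub>R N v)) u \<bullet> N u = r * K u * (pd i X u \<bullet> pd j X u) - \<beta> j i u" for i j
    by (simp add: pd_pd_parallel[OF u] inner_add_left pd_pd_X_inner_N[OF u] pd_pd_N_inner_N[OF u] third_eq[OF u])
  then have "det ((\<chi> i j. pd i (pd j (\<lambda>v. X v + r *\<^sub>R N v)) u \<bullet> N u) :: real^2^2)
      = (r * K u * (pd 1 X u \<bullet> pd 1 X u) - \<beta> 1 1 u) * (r * K u * (pd 2 X u \<bullet> pd 2 X u) - \<beta> 2 2 u)
        - (r * K u * (pd 1 X u \<bullet> pd 2 X u) - \<beta> 1 2 u)\<^sup>2"
    by (simp add: det_2 sym power2_eq_square)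
  then show ?thesis
    using minimal[OF u] det_\<beta>[OF u] unfolding det_gram by algebra
qed

end

section \<open>The parallel surface\<close>

lemma parallel_surface_simps [simp]:
  "carr (parallel_surface r M) = carr M" "atlas (parallel_surface r M) = atlas M"
  "nrm (parallel_surface r M) = nrm M" "form3 (parallel_surface r M) = form3 M"
  "pos (parallel_surface r M) = (\<lambda>a. pos M a + r *\<^sub>R nrm M a)"
  by (simp_all add: parallel_surface_def form3_def fun_eq_iff)

lemma form1_eq_gram: "form1 M p = gram (pos M \<circ> p)"
  and form3_eq_gram: "form3 M p = gram (nrm M \<circ> p)"
  by (simp_all add: form1_def form3_def gram_def fun_eq_iff)

lemma patch_of_surface:
  assumes "surface M" "(U, p) \<in> atlas M"
  shows "patch U (pos M \<circ> p) (nrm M \<circ> p)"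
proof -
  have "\<forall>(U, p)\<in>atlas M.
      open U \<and> embedding_map (top_of_set U) (carr M) p \<and> openin (carr M) (p ` U)"
    and "\<forall>(U, p)\<in>atlas M.
      C2_on U (pos M \<circ> p) \<and> C2_on U (nrm M \<circ> p) \<and>
      (\<forall>u\<in>U. inj (frechet_derivative (pos M \<circ> p) (at u)) \<and>
         norm (nrm M (p u)) = 1 \<and> (\<forall>i. pd i (pos M \<circ> p) u \<bullet> nrm M (p u) = 0))"
    using assms(1) unfolding surface_def by - (elim conjE, assumption)+
  from this[THEN bspec, OF assms(2)] show ?thesis
    by (auto simp: patch_def)
qed

lemma det_form1_nonzero:
  assumes M: "surface M" "(U, p) \<in> atlas M" and u: "u \<in> U"
  shows "det (form1 M p u) \<noteq> 0"
proof -
  interpret patch U "pos M \<circ> p" "nrm M \<circ> p"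
    by (rule patch_of_surface[OF M])
  have "inj (frechet_derivative (pos M \<circ> p) (at u))"
  proof -
    have "\<forall>(U, p)\<in>atlas M.
        C2_on U (pos M \<circ> p) \<and> C2_on U (nrm M \<circ> p) \<and>
        (\<forall>u\<in>U. inj (frechet_derivative (pos M \<circ> p) (at u)) \<and>
           norm (nrm M (p u)) = 1 \<and> (\<forall>i. pd i (pos M \<circ> p) u \<bullet> nrm M (p u) = 0))"
      using M(1) unfolding surface_def by (elim conjE)
    from bspec[OF this M(2)] show ?thesis
      using u by simp
  qed
  then show ?thesis
    using inj_frechet_derivative_iff_det_gram[OF C2_on_differentiable[OF X_C2 open_U u]]
    by (simp add: form1_eq_gram)
qed

lemma form2_eq_\<beta>:
  assumes "surface M" "(U, p) \<in> atlas M" "u \<in> U"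
  shows "form2 M p u $ i $ j = - patch.\<beta> (pos M \<circ> p) (nrm M \<circ> p) j i u"
  using patch.pd_pd_X_inner_N[OF patch_of_surface[OF assms(1,2)] assms(3), of i j]
  by (simp add: form2_def)

text \<open>The conditions of \<open>minimal_patch\<close> are H = 0 and K ~= 0 cleared of the
  denominator det I. The sign between \<open>form2\<close> and \<beta> is harmless: the trace is
  zero and the determinant has even order.\<close>

lemma minimal_patch_of_surface:
  assumes "minimal_surface M" "no_parabolic_points M" "(U, p) \<in> atlas M"
  shows "minimal_patch U (pos M \<circ> p) (nrm M \<circ> p)"
proof -
  have M: "surface M"
    using assms(1) by (simp add: minimal_surface_def)
  interpret patch U "pos M \<circ> p" "nrm M \<circ> p"
    by (rule patch_of_surface[OF M assms(3)])
  show ?thesis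
  proof
    fix u assume u: "u \<in> U"
    note form2 = form2_eq_\<beta>[OF M assms(3) u] and d = det_form1_nonzero[OF M assms(3) u, unfolded form1_eq_gram]
    show "det (gram (pos M \<circ> p) u) \<noteq> 0"
      by (rule d)
    have "mean_curv M p u = 0" "gauss_curv M p u \<noteq> 0"
      using assms u by (auto simp: minimal_surface_def no_parabolic_points_def)
    then have H: "trace (matrix_inv (form1 M p u) ** form2 M p u) = 0" and K: "det (form2 M p u) \<noteq> 0"
      by (auto simp: mean_curv_def gauss_curv_def)
    have "det (gram (pos M \<circ> p) u) * trace (matrix_inv (form1 M p u) ** form2 M p u)
        = - ((pd 2 (pos M \<circ> p) u \<bullet> pd 2 (pos M \<circ> p) u) * \<beta> 1 1 u
          - 2 * (pd 1 (pos M \<circ> p) u \<bullet> pd 2 (pos M \<circ> p) u) * \<beta> 1 2 u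
          + (pd 1 (pos M \<circ> p) u \<bullet> pd 1 (pos M \<circ> p) u) * \<beta> 2 2 u)"
      using d by (simp add: trace_def sum_2 matrix_matrix_mult_def matrix_inv_2[OF d] form2 \<beta>_commute[OF u, of 2 1]
          form1_eq_gram inner_commute[of "pd 2 _ u" "pd 1 _ u"] distrib_left right_diff_distrib)
    with H show "(pd 2 (pos M \<circ> p) u \<bullet> pd 2 (pos M \<circ> p) u) * \<beta> 1 1 u
          - 2 * (pd 1 (pos M \<circ> p) u \<bullet> pd 2 (pos M \<circ> p) u) * \<beta> 1 2 u
          + (pd 1 (pos M \<circ> p) u \<bullet> pd 1 (pos M \<circ> p) u) * \<beta> 2 2 u = 0"
      by simp
    show "\<beta> 1 1 u * \<beta> 2 2 u - (\<beta> 1 2 u)\<^sup>2 \<noteq> 0"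
      using K by (simp add: det_2 form2 \<beta>_commute[OF u, of 2 1] power2_eq_square)
  qed
qed

lemma gauss_curv_eq_K:
  assumes "minimal_surface M" "no_parabolic_points M" "(U, p) \<in> atlas M" "u \<in> U"
  shows "minimal_patch.K (pos M \<circ> p) (nrm M \<circ> p) u = gauss_curv M p u"
proof -
  have M: "surface M"
    using assms(1) by (simp add: minimal_surface_def)
  interpret minimal_patch U "pos M \<circ> p" "nrm M \<circ> p"
    by (rule minimal_patch_of_surface[OF assms(1-3)])
  show ?thesis
    using \<beta>_commute[OF assms(4), of 2 1]
    by (simp add: K_def gauss_curv_def form1_eq_gram det_2[of "form2 _ _ _"] form2_eq_\<beta>[OF M assms(3,4)] power2_eq_square)
qed

theorem theorem4p3:
  fixes M :: "'a surf" and \<rho> :: real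
  assumes "minimal_surface M"
    and "no_parabolic_points M"
    and "\<rho> \<noteq> 0"
    and "\<forall>(U, p)\<in>atlas M. \<forall>u\<in>U.
           1 - 2 * \<rho> * mean_curv M p u + \<rho>\<^sup>2 * gauss_curv M p u \<noteq> 0"
  shows "null_III_type (parallel_surface \<rho> M) 2"
proof -
  let ?M = "parallel_surface \<rho> M"
  have M: "surface M"
    using assms(1) by (simp add: minimal_surface_def)
  have patch: "minimal_patch U (pos M \<circ> p) (nrm M \<circ> p)" if "(U, p) \<in> atlas M" for U p
    using minimal_patch_of_surface[OF assms(1,2) that] .
  have K: "1 + \<rho>\<^sup>2 * minimal_patch.K (pos M \<circ> p) (nrm M \<circ> p) u \<noteq> 0"
    if "(U, p) \<in> atlas M" "u \<in> U" for U p u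
  proof -
    have "mean_curv M p u = 0" "1 - 2 * \<rho> * mean_curv M p u + \<rho>\<^sup>2 * gauss_curv M p u \<noteq> 0"
      using assms(1,4) that by (auto simp: minimal_surface_def)
    then show ?thesis
      by (simp add: gauss_curv_eq_K[OF assms(1,2) that])
  qed
  have comp: "pos ?M \<circ> p = (\<lambda>v. (pos M \<circ> p) v + \<rho> *\<^sub>R (nrm M \<circ> p) v)" for p
    by (simp add: fun_eq_iff)
  \<comment> \<open>Topology, atlas and normal are those of \<open>M\<close>; only the conditions
    that involve the position vector have to be checked anew.\<close>
  have chart: "C2_on U (pos ?M \<circ> p)"
    "u \<in> U \<Longrightarrow> det (gram (pos ?M \<circ> p) u) \<noteq> 0"
    "u \<in> U \<Longrightarrow> inj (frechet_derivative (pos ?M \<circ> p) (at u))"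
    "u \<in> U \<Longrightarrow> pd i (pos ?M \<circ> p) u \<bullet> nrm M (p u) = 0"
    "u \<in> U \<Longrightarrow> gauss_curv ?M p u \<noteq> 0"
    if Up: "(U, p) \<in> atlas M" for U p u i
  proof -
    interpret minimal_patch U "pos M \<circ> p" "nrm M \<circ> p"
      by (rule patch[OF Up])
    show C2: "C2_on U (pos ?M \<circ> p)"
      unfolding comp by (intro C2_on_add C2_on_scaleR open_U X_C2 N_C2)
    assume u: "u \<in> U"
    show d: "det (gram (pos ?M \<circ> p) u) \<noteq> 0"
      unfolding comp det_gram_parallel[OF u] using K[OF Up u] regular[OF u] by simp
    then show "inj (frechet_derivative (pos ?M \<circ> p) (at u))"
      using inj_frechet_derivative_iff_det_gram[OF C2_on_differentiable[OF C2 open_U u]] by blast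
    show "pd i (pos ?M \<circ> p) u \<bullet> nrm M (p u) = 0"
      unfolding comp pd_parallel[OF u]
      using pd_X_inner_N[OF u, of i] pd_N_inner_N[OF u, of i] by (simp add: inner_add_left)
    have "det (form2 ?M p u) \<noteq> 0"
      using det_second_parallel[OF u, of \<rho>] K[OF Up u] K_nonzero[OF u] regular[OF u]
      unfolding form2_def comp by simp
    with d show "gauss_curv ?M p u \<noteq> 0"
      by (simp add: gauss_curv_def form1_eq_gram)
  qed
  have surf: "surface ?M"
  proof -
    have "norm (nrm M (p u)) = 1" if "(U, p) \<in> atlas M" "u \<in> U" for U p u
      using patch.norm_N[OF patch_of_surface[OF M that(1)] that(2)] by simp
    moreover have "C2_on U (nrm M \<circ> p)" if "(U, p) \<in> atlas M" for U p
      using patch.N_C2[OF patch_of_surface[OF M that]] .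
    ultimately have "\<forall>(U, p)\<in>atlas ?M.
        C2_on U (pos ?M \<circ> p) \<and> C2_on U (nrm ?M \<circ> p) \<and>
        (\<forall>u\<in>U. inj (frechet_derivative (pos ?M \<circ> p) (at u)) \<and>
           norm (nrm ?M (p u)) = 1 \<and> (\<forall>i. pd i (pos ?M \<circ> p) u \<bullet> nrm ?M (p u) = 0))"
      using chart unfolding parallel_surface_simps(2,3) by (auto simp del: parallel_surface_simps(5))
    with M show ?thesis
      unfolding surface_def parallel_surface_simps(1,2) by blast
  qed
  have no_parabolic: "no_parabolic_points ?M"
    using chart(5) by (auto simp: no_parabolic_points_def)
  \<comment> \<open>Only the indices 1 and 2 matter; the constant vector of the decomposition will
    be 0.\<close>
  define x where "x = (\<lambda>i::nat. if i = 1 then pos M else (\<lambda>a. \<rho> *\<^sub>R nrm M a))"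
  define l where "l = (\<lambda>i::nat. if i = 1 then 0 else 2 :: real)"
  have range: "{1..2} = {1, 2::nat}" "{Suc 0..2} = {1, 2}"
    by auto
  have eigen1: "eigenmap_III ?M 0 (pos M)"
    unfolding eigenmap_III_def
  proof (clarsimp, intro conjI ballI)
    fix U p assume Up: "(U, p) \<in> atlas M"
    interpret minimal_patch U "pos M \<circ> p" "nrm M \<circ> p"
      by (rule patch[OF Up])
    show "C2_on U (pos M \<circ> p)"
      by (rule X_C2)
    show "beltrami_III ?M p (pos M) u = 0" if "u \<in> U" for u
      using beltrami_X[OF that] by (simp add: beltrami_III_def form3_eq_gram)
  qed
  have eigen2: "eigenmap_III ?M 2 (\<lambda>a. \<rho> *\<^sub>R nrm M a)"
    unfolding eigenmap_III_def
  proof (clarsimp, intro conjI ballI)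
    fix U p assume Up: "(U, p) \<in> atlas M"
    interpret minimal_patch U "pos M \<circ> p" "nrm M \<circ> p"
      by (rule patch[OF Up])
    show "C2_on U ((\<lambda>a. \<rho> *\<^sub>R nrm M a) \<circ> p)"
      using C2_on_scaleR[OF open_U N_C2, of \<rho>] by (simp add: o_def)
    show "beltrami_III ?M p (\<lambda>a. \<rho> *\<^sub>R nrm M a) u = (2 * \<rho>) *\<^sub>R nrm M (p u)" if "u \<in> U" for u
      using beltrami_third_scaleR[OF that N_C2 det_third_nonzero[OF that], of \<rho>] beltrami_N[OF that]
      by (simp add: beltrami_III_def form3_eq_gram mult.commute)
  qed
  \<comment> \<open>One point of one chart suffices: nondegeneracy of I and of III there makes both
    summands nonconstant.\<close>
  obtain U p u where Up: "(U, p) \<in> atlas M" and u: "u \<in> U" and sub: "p ` U \<subseteq> topspace (carr M)"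
  proof -
    have "topspace (carr M) \<noteq> {}" "(\<Union>(U, p)\<in>atlas M. p ` U) = topspace (carr M)"
      using M unfolding surface_def by blast+
    then show ?thesis
      using that by blast
  qed
  interpret minimal_patch U "pos M \<circ> p" "nrm M \<circ> p"
    by (rule patch[OF Up])
  have "\<not> pos M constant_on topspace (carr M)"
    using not_constant_on_if_det_gram[OF open_U u regular[OF u]] sub
    by (fastforce simp: constant_on_def)
  moreover have "\<not> (\<lambda>a. \<rho> *\<^sub>R nrm M a) constant_on topspace (carr M)"
  proof
    assume "(\<lambda>a. \<rho> *\<^sub>R nrm M a) constant_on topspace (carr M)"
    then obtain c where "\<And>a. a \<in> topspace (carr M) \<Longrightarrow> \<rho> *\<^sub>R nrm M a = c"
      by (auto simp: constant_on_def)
    \<comment> \<open>Here rho ~= 0 enters: the second summand determines the normal.\<close>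
    then have "nrm M (p v) = inverse \<rho> *\<^sub>R c" if "v \<in> U" for v
      using that sub assms(3) by fastforce
    then show False
      using not_constant_on_if_det_gram[OF open_U u det_third_nonzero[OF u]]
      by (auto simp: constant_on_def)
  qed
  ultimately have "III_decomposition ?M 2 l 0 x"
    using eigen1 eigen2 by (simp add: III_decomposition_def range x_def l_def)
  moreover have "\<exists>i\<in>{1..2}. l i = 0"
    by (simp add: range l_def)
  ultimately show ?thesis
    using surf no_parabolic unfolding null_III_type_def by blast
qed

end
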